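(* Let $p$ be a prime and $n\geq 1$ an integer, let $G(\mathbb{Z}_{p^{n}})=(V,E)$ be the unit graph of $\mathbb{Z}_{p^n}$, and let $H$ be a $|V|\times|E|$ incidence matrix of $G(\mathbb{Z}_{p^{n}})$. (1) If $p$ is odd, then the binary code $C_2(H)$ generated by $H$ is a $\left[\frac{\phi(p^{n})(p^{n}-1)}{2},\,p^{n}-1,\,\phi(p^{n})-1\right]_{2}$ code over $\mathbb{F}_2$. (2) If $p=2$, then for any odd prime $q$ the $q$-ary code $C_q(H)$ generated by $H$ is a $\left[2^{2(n-1)},\,2^{n}-1,\,2^{n-1}\right]_{q}$ code over $\mathbb{F}_q$.
   Context: The unit graph $G(\mathbb{Z}_N)$ is the simple graph with vertex set $\mathbb{Z}_N$ in which two distinct vertices $x,y$ are adjacent iff $x+y$ is a unit of $\mathbb{Z}_N$. An incidence matrix of a graph has rows indexed by vertices and columns by edges, with entry $1$ if the vertex is an endpoint of the edge and $0$ otherwise. For a prime $q$, $C_q(H)$ denotes the $\mathbb{F}_q$-span of the rows of $H$ (entries read in $\mathbb{F}_q$), a subspace of $\mathbb{F}_q^{|E|}$. An $[N,k,d]_q$ code is a linear subspace of $\mathbb{F}_q^N$ of dimension $k$ whose minimum Hamming weight of nonzero vectors (equivalently, minimum distance) is $d$. $\phi$ is Euler's totient function. *)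

theory Defs
  imports
    "Berlekamp_Zassenhaus.Finite_Field"
    "Jordan_Normal_Form.VS_Connect"
    "HOL-Number_Theory.Residues"
begin

text \<open>
  Edges are two-element vertex sets \<open>{x, y}\<close>; the vertex set of the unit graph of \<open>R\<close>
  is \<open>carrier R\<close>. The ring \<open>\<int>\<^sub>m\<close> is \<open>residue_ring m\<close> (an \<open>int ring\<close>, hence the \<open>int\<close> coercions).
\<close>

definition unit_graph_edges :: "('v, 'b) ring_scheme \<Rightarrow> 'v set set" where
  "unit_graph_edges R =
     {{x, y} | x y. x \<in> carrier R \<and> y \<in> carrier R \<and> x \<noteq> y \<and> x \<oplus>\<^bsub>R\<^esub> y \<in> Units R}"

text \<open>
  Rows and columns of a matrix are numbered, so an incidence matrix depends on the choice of
  an ordering of the vertices and one of the edges; any choice is admitted.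
\<close>

definition is_incidence_matrix :: "'v set \<Rightarrow> 'v set set \<Rightarrow> int mat \<Rightarrow> bool" where
  "is_incidence_matrix V E H \<longleftrightarrow>
     (\<exists>vs es. distinct vs \<and> set vs = V \<and> distinct es \<and> set es = E \<and>
        H = mat (length vs) (length es) (\<lambda>(i, j). if vs ! i \<in> es ! j then 1 else 0))"

text \<open>
  \<open>C\<^sub>q(H)\<close> is \<open>row_code H :: 'q mod_ring vec set\<close> with \<open>q = CARD('q)\<close> prime; in particular
  \<open>bool mod_ring\<close> is the field with two elements.
\<close>

definition row_code :: "int mat \<Rightarrow> 'a::field vec set" where
  "row_code H = vec_space.row_space (dim_col H) (map_mat of_int H)"

definition hamming_weight :: "'a::zero vec \<Rightarrow> nat" where
  "hamming_weight v = card {i. i < dim_vec v \<and> v $ i \<noteq> 0}"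

text \<open>\<open>C\<close> is an \<open>[N, k, d]\<close> code over the field \<open>'a\<close>.\<close>

definition is_linear_code :: "'a::field vec set \<Rightarrow> nat \<Rightarrow> nat \<Rightarrow> nat \<Rightarrow> bool" where
  "is_linear_code C N k d \<longleftrightarrow>
     VectorSpace.subspace class_ring C (module_vec TYPE('a) N) \<and>
     vectorspace.dim class_ring ((module_vec TYPE('a) N)\<lparr>carrier := C\<rparr>) = k \<and>
     (\<exists>c\<in>C. c \<noteq> 0\<^sub>v N \<and> hamming_weight c = d) \<and>
     (\<forall>c\<in>C. c \<noteq> 0\<^sub>v N \<longrightarrow> d \<le> hamming_weight c)"

end

theory Submission
  imports Defs "Jordan_Normal_Form.DL_Rank"
begin

text \<open>
  The codewords are the edge labellings \<open>{x, y} \<mapsto> f x + f y\<close>, so the code has dimension \<open>|V| - 1\<close>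
  as soon as the labellings \<open>f\<close> that vanish on all edges form a line. In characteristic 2 the weight
  of a codeword is the size of an edge cut; for odd \<open>p\<close> the unit graph has diameter at most 2, so by
  Plesnik's theorem no cut is smaller than the minimum degree. For \<open>p = 2\<close> the graph is complete
  bipartite, with the even and the odd residues as its sides.
\<close>

section \<open>Linear maps with a one-dimensional kernel\<close>

text \<open>Rank-nullity: the kernel is the line spanned by the nonzero vector \<open>w\<close>, so
  the nullity is 1. The matrix stays abstract because the two parities of \<open>p\<close> lead to
  different vectors \<open>w\<close>.\<close>

lemma
  fixes A :: "'a::field mat"
  assumes A: "A \<in> carrier_mat nr nc" and w: "w \<in> carrier_vec nc" "w \<noteq> 0\<^sub>v nc"
    and ker: "\<And>v. v \<in> carrier_vec nc \<Longrightarrow> A *\<^sub>v v = 0\<^sub>v nr \<longleftrightarrow> (\<exists>c. v = c \<cdot>\<^sub>v w)"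
  shows dim_range_mult_mat_vec:
      "vectorspace.dim class_ring
        ((module_vec TYPE('a) nr)\<lparr>carrier := (\<lambda>v. A *\<^sub>v v) ` carrier_vec nc\<rparr>) = nc - 1"
    and subspace_range_mult_mat_vec:
      "VectorSpace.subspace class_ring ((\<lambda>v. A *\<^sub>v v) ` carrier_vec nc) (module_vec TYPE('a) nr)"
proof -
  interpret V: vec_space "TYPE('a)" nc .
  interpret W: vec_space "TYPE('a)" nr .
  interpret T: linear_map class_ring V.V W.V "\<lambda>v. A *\<^sub>v v"
    by unfold_locales
       (use A in \<open>auto simp: module_hom_def mult_add_distrib_mat_vec mult_mat_vec\<close>)
  have im: "T.im = (\<lambda>v. A *\<^sub>v v) ` carrier_vec nc"
    by (simp add: T.im_def)
  have lincomb: "V.lincomb a {w} = a w \<cdot>\<^sub>v w" for a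
    using w by (simp add: V.lincomb_def)
  have kerT: "T.ker = V.span {w}"
  proof -
    have "V.span {w} = {c \<cdot>\<^sub>v w | c. True}"
      using w by (subst V.finite_span) (auto simp: lincomb Pi_def intro: exI[of _ "\<lambda>_. c" for c])
    then show ?thesis using ker w by (auto simp: T.ker_def)
  qed
  \<comment> \<open>A nonzero coordinate of \<open>w\<close> witnesses independence: a vanishing
    multiple of \<open>w\<close> vanishes at \<open>i\<close>, which forces its coefficient to be
    0.\<close>
  obtain i where i: "i < nc" "w $ i \<noteq> 0"
    using w by (metis carrier_vecD eq_vecI index_zero_vec(1) index_zero_vec(2))
  have "V.lin_indpt {w}"
  proof (rule V.finite_lin_indpt2)
    fix a assume "V.lincomb a {w} = 0\<^sub>v nc"
    then have "(a w \<cdot>\<^sub>v w) $ i = 0" using i by (simp add: lincomb)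
    then show "\<forall>v\<in>{w}. a v = 0" using i w by simp
  qed (use w in auto)
  then have "vectorspace.dim class_ring (V.vs T.ker) = 1"
    unfolding kerT using V.dim_span[of "{w}" "{w}"] w by (auto simp: maximal_def)
  then show "vectorspace.dim class_ring (W.V\<lparr>carrier := (\<lambda>v. A *\<^sub>v v) ` carrier_vec nc\<rparr>) = nc - 1"
    using T.rank_nullity V.dim_is_n V.fin_dim by (simp add: im)
  show "VectorSpace.subspace class_ring ((\<lambda>v. A *\<^sub>v v) ` carrier_vec nc) W.V"
    using T.imT_is_subspace by (simp add: im)
qed

section \<open>From edge labellings to code parameters\<close>

text \<open>This turns the scalar product of a 0/1 column of an incidence matrix with a vector of
  labels into the sum of the labels over one edge.\<close>

lemma sum_nth_distinct:
  assumes "distinct xs" "A \<subseteq> set xs"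
  shows "(\<Sum>i<length xs. if xs ! i \<in> A then f (xs ! i) else 0) = sum f A"
proof -
  have "(\<Sum>i<length xs. if xs ! i \<in> A then f (xs ! i) else 0)
      = (\<Sum>x\<in>set xs. if x \<in> A then f x else 0)"
    using assms(1) by (intro sum.reindex_bij_betw bij_betw_nth) auto
  also have "\<dots> = sum f A"
    using assms(2) by (simp add: sum.If_cases Int_absorb1)
  finally show ?thesis .
qed

text \<open>Reduces the code parameters to statements about vertex labellings \<open>f\<close>,
  whose codewords have the entries \<open>sum f e\<close>. The hypothesis \<open>ker\<close> fixes
  the dimension: the labellings with zero codeword are, on \<open>V\<close>, the multiples of
  \<open>s\<close>. The row of \<open>x1\<close> has weight \<open>d\<close>, and \<open>min\<close>
  makes \<open>d\<close> a lower bound.\<close>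

lemma is_linear_code_incidence:
  fixes H :: "int mat" and s :: "'v \<Rightarrow> 'a::field"
  assumes H: "is_incidence_matrix V E H" and EV: "\<Union>E \<subseteq> V"
    and s: "x0 \<in> V" "s x0 \<noteq> 0"
    and ker: "\<And>f :: 'v \<Rightarrow> 'a. (\<forall>e\<in>E. sum f e = 0) \<longleftrightarrow> (\<exists>c. \<forall>x\<in>V. f x = c * s x)"
    and star: "x1 \<in> V" "card {e\<in>E. x1 \<in> e} = d" "d > 0"
    and min: "\<And>f :: 'v \<Rightarrow> 'a. \<exists>e\<in>E. sum f e \<noteq> 0 \<Longrightarrow> d \<le> card {e\<in>E. sum f e \<noteq> 0}"
  shows "is_linear_code (row_code H :: 'a vec set) (card E) (card V - 1) d"
proof -
  obtain vs es where vs: "distinct vs" "set vs = V" and es: "distinct es" "set es = E"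
    and H_eq: "H = mat (length vs) (length es) (\<lambda>(i, j). if vs ! i \<in> es ! j then 1 else 0)"
    using H unfolding is_incidence_matrix_def by blast
  have cards: "card V = length vs" "card E = length es"
    using vs es distinct_card by blast+
  \<comment> \<open>The row space of \<open>H\<close> is the image of its transpose, which acts on
    vectors indexed by vertices, that is, on labellings.\<close>
  define A :: "'a mat" where "A = (map_mat of_int H)\<^sup>T"
  have A: "A \<in> carrier_mat (length es) (length vs)"
    by (simp add: A_def H_eq)
  define word :: "('v \<Rightarrow> 'a) \<Rightarrow> 'a vec" where
    "word f = vec (length es) (\<lambda>j. sum f (es ! j))" for f
  have A_vec: "A *\<^sub>v vec (length vs) (\<lambda>i. f (vs ! i)) = word f" for f
  proof (rule eq_vecI)
    fix j assume j: "j < dim_vec (word f)"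
    then have j': "j < length es" by (simp add: word_def)
    then have "es ! j \<subseteq> set vs" using EV es vs nth_mem by blast
    from sum_nth_distinct[OF vs(1) this, of f]
    have "word f $ j = (\<Sum>i<length vs. if vs ! i \<in> es ! j then f (vs ! i) else 0)"
      using j' by (simp add: word_def)
    then show "(A *\<^sub>v vec (length vs) (\<lambda>i. f (vs ! i))) $ j = word f $ j"
      using j' by (auto simp: A_def H_eq scalar_prod_def lessThan_atLeast0 intro!: sum.cong)
  qed (use A in \<open>simp add: word_def\<close>)
  have vec_ex: "\<exists>f. v = vec (length vs) (\<lambda>i. f (vs ! i))" if "v \<in> carrier_vec (length vs)" for v :: "'a vec"
  proof -
    \<comment> \<open>The label of a vertex is the coordinate of \<open>v\<close> at the position of
      that vertex in \<open>vs\<close>; labels outside \<open>V\<close> are irrelevant.\<close>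
    have "v = vec (length vs) (\<lambda>i. v $ the_inv_into {..<length vs} ((!) vs) (vs ! i))"
      using that vs(1)
      by (intro eq_vecI) (auto simp: the_inv_into_f_f inj_on_def nth_eq_iff_index_eq)
    then show ?thesis by (rule exI[of _ "\<lambda>x. v $ the_inv_into {..<length vs} ((!) vs) x"])
  qed
  have range: "(\<lambda>v. A *\<^sub>v v) ` carrier_vec (length vs) = range word"
  proof (intro equalityI image_subsetI)
    show "A *\<^sub>v v \<in> range word" if "v \<in> carrier_vec (length vs)" for v
      using vec_ex[OF that] A_vec by auto
    show "word f \<in> (\<lambda>v. A *\<^sub>v v) ` carrier_vec (length vs)" for f
      using A_vec[of f] by (metis imageI vec_carrier)
  qed
  have code: "row_code H = (\<lambda>v. A *\<^sub>v v) ` carrier_vec (length vs)"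
  proof -
    have "(map_mat of_int H :: 'a mat) \<in> carrier_mat (length vs) (length es)"
      by (simp add: H_eq)
    note space = vec_space.row_space_eq[OF this, folded A_def]
    have "dim_col H = length es" "dim_row H = length vs"
      by (simp_all add: H_eq)
    then show ?thesis
      using A by (auto simp: row_code_def space)
  qed
  have word_0: "word f = 0\<^sub>v (length es) \<longleftrightarrow> (\<forall>e\<in>E. sum f e = 0)" for f
    unfolding es(2)[symmetric] all_set_conv_all_nth by (auto simp: word_def vec_eq_iff)
  have weight: "hamming_weight (word f) = card {e\<in>E. sum f e \<noteq> 0}" for f
  proof -
    have "bij_betw ((!) es) {j. j < length es \<and> sum f (es ! j) \<noteq> 0} {e\<in>E. sum f e \<noteq> 0}"
      using es by (auto simp: bij_betw_def inj_on_def nth_eq_iff_index_eq in_set_conv_nth image_iff)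
    then have "card {j. j < length es \<and> sum f (es ! j) \<noteq> 0} = card {e\<in>E. sum f e \<noteq> 0}"
      by (rule bij_betw_same_card)
    moreover have "{j. j < dim_vec (word f) \<and> word f $ j \<noteq> 0}
        = {j. j < length es \<and> sum f (es ! j) \<noteq> 0}"
      by (auto simp: word_def)
    ultimately show ?thesis by (simp add: hamming_weight_def)
  qed
  define w where "w = vec (length vs) (\<lambda>i. s (vs ! i))"
  obtain i0 where i0: "i0 < length vs" "vs ! i0 = x0"
    using s(1) vs by (metis in_set_conv_nth)
  have w0: "w \<noteq> 0\<^sub>v (length vs)"
    using i0 s(2) by (metis index_vec index_zero_vec(1) w_def)
  have kerA: "A *\<^sub>v v = 0\<^sub>v (length es) \<longleftrightarrow> (\<exists>c. v = c \<cdot>\<^sub>v w)" if "v \<in> carrier_vec (length vs)" for v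
  proof -
    from vec_ex[OF that] obtain f where f: "v = vec (length vs) (\<lambda>i. f (vs ! i))" ..
    have "(\<forall>x\<in>V. f x = c * s x) \<longleftrightarrow> v = c \<cdot>\<^sub>v w" for c
      unfolding vs(2)[symmetric] all_set_conv_all_nth by (auto simp: f w_def vec_eq_iff)
    then show ?thesis by (simp add: f A_vec word_0 ker)
  qed
  have w: "w \<in> carrier_vec (length vs)" by (simp add: w_def)
  note lin = dim_range_mult_mat_vec[OF A w w0 kerA] subspace_range_mult_mat_vec[OF A w w0 kerA]
  \<comment> \<open>The codeword of the indicator of \<open>x1\<close> is the row of
    \<open>H\<close> at \<open>x1\<close>; its support consists of the edges through
    \<open>x1\<close>.\<close>
  define g :: "'v \<Rightarrow> 'a" where "g = (\<lambda>x. if x = x1 then 1 else 0)"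
  have "sum g e \<noteq> 0 \<longleftrightarrow> x1 \<in> e" if "e \<in> E" for e
  proof -
    have "finite e"
      using that EV vs by (metis List.finite_set Sup_upper finite_subset)
    then show ?thesis by (simp add: g_def)
  qed
  then have "{e\<in>E. sum g e \<noteq> 0} = {e\<in>E. x1 \<in> e}" by auto
  then have g: "card {e\<in>E. sum g e \<noteq> 0} = d" using star by simp
  \<comment> \<open>Positivity of \<open>d\<close> is what makes this row a nonzero
    codeword.\<close>
  have "word g \<noteq> 0\<^sub>v (length es)"
    using g star(3) unfolding word_0 by (metis (mono_tags, lifting) card.empty empty_Collect_eq less_irrefl)
  with g weight have attained: "\<exists>c\<in>range word. c \<noteq> 0\<^sub>v (length es) \<and> hamming_weight c = d"
    by auto
  show ?thesis
    unfolding is_linear_code_def cards code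
    using lin attained min by (auto simp: range word_0 weight)
qed

section \<open>Lower bounds for edge cuts\<close>

text \<open>Fix \<open>x\<close> in \<open>S\<close>. Each neighbour of \<open>x\<close> outside
  \<open>S\<close> gives a cut edge at \<open>x\<close>, and each neighbour inside \<open>S\<close>
  is one of the other vertices of \<open>S\<close>, all of which have a cut edge of their own. So
  the cut is at least as large as the degree of \<open>x\<close>.\<close>

lemma edge_boundary_ge_if_no_interior:
  assumes V: "finite V" and S: "S \<subseteq> V" "S \<noteq> {}"
    and irrefl: "\<And>x. \<not> adj x x"
    and deg: "\<And>x. x \<in> V \<Longrightarrow> d \<le> card {y\<in>V. adj x y}"
    and nbr: "\<And>x. x \<in> S \<Longrightarrow> \<exists>y\<in>V - S. adj x y"
  shows "d \<le> card {(x, y). x \<in> S \<and> y \<in> V - S \<and> adj x y}"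
proof -
  define k where "k x = card {y\<in>V - S. adj x y}" for x
  have finS: "finite S" using V S finite_subset by blast
  have pos: "1 \<le> k x" if "x \<in> S" for x
    using nbr[OF that] V by (auto simp: k_def Suc_le_eq card_gt_0_iff)
  obtain x where x: "x \<in> S" using S by blast
  have "{y\<in>V. adj x y} \<subseteq> {y\<in>V - S. adj x y} \<union> (S - {x})" using irrefl by auto
  then have "card {y\<in>V. adj x y} \<le> card ({y\<in>V - S. adj x y} \<union> (S - {x}))"
    using V finS by (intro card_mono) auto
  also have "\<dots> \<le> k x + card (S - {x})"
    unfolding k_def by (rule card_Un_le)
  also have "card (S - {x}) \<le> (\<Sum>y\<in>S - {x}. k y)"
    using sum_mono[of "S - {x}" "\<lambda>_. 1" k] pos by simp
  also have "k x + (\<Sum>y\<in>S - {x}. k y) = (\<Sum>y\<in>S. k y)"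
    using finS x by (simp add: sum.remove)
  also have "\<dots> = card (SIGMA x:S. {y\<in>V - S. adj x y})"
    using finS V by (simp add: k_def)
  also have "(SIGMA x:S. {y\<in>V - S. adj x y}) = {(x, y). x \<in> S \<and> y \<in> V - S \<and> adj x y}"
    by auto
  finally show ?thesis using deg[of x] S x by auto
qed

text \<open>Plesnik's theorem: if both sides of a cut contain a vertex with all neighbours on its own side,
  these two vertices are at distance at least 3.\<close>

lemma edge_boundary_ge_if_diameter_2:
  assumes V: "finite V" and S: "S \<subseteq> V" "S \<noteq> {}" "S \<noteq> V"
    and irrefl: "\<And>x. \<not> adj x x" and sym: "\<And>x y. adj x y \<Longrightarrow> adj y x"
    and deg: "\<And>x. x \<in> V \<Longrightarrow> d \<le> card {y\<in>V. adj x y}"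
    and diam: "\<And>x y. \<lbrakk>x \<in> V; y \<in> V; x \<noteq> y; \<not> adj x y\<rbrakk> \<Longrightarrow> \<exists>z\<in>V. adj x z \<and> adj z y"
  shows "d \<le> card {(x, y). x \<in> S \<and> y \<in> V - S \<and> adj x y}"
proof -
  consider "\<forall>x\<in>S. \<exists>y\<in>V - S. adj x y" | "\<forall>x\<in>V - S. \<exists>y\<in>S. adj x y"
    using diam S(1) sym by (metis DiffE DiffI subsetD)
  then show ?thesis
  proof cases
    case 1
    then show ?thesis
      using edge_boundary_ge_if_no_interior[OF V S(1,2), of adj d] irrefl deg by blast
  next
    case 2
    \<comment> \<open>The previous lemma is applied to the complement of \<open>S\<close>, whose cut
      is the same up to swapping the pairs.\<close>
    have eq: "V - (V - S) = S" using S by auto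
    have "d \<le> card {(x, y). x \<in> V - S \<and> y \<in> V - (V - S) \<and> adj x y}"
      using 2 S irrefl deg
      by (intro edge_boundary_ge_if_no_interior[OF V]) (auto simp: eq)
    also have "{(x, y). x \<in> V - S \<and> y \<in> V - (V - S) \<and> adj x y}
        = prod.swap ` {(x, y). x \<in> S \<and> y \<in> V - S \<and> adj x y}"
      unfolding eq using sym by (auto simp: image_iff)
    also have "card \<dots> = card {(x, y). x \<in> S \<and> y \<in> V - S \<and> adj x y}"
      by (intro card_image) (auto simp: inj_on_def)
    finally show ?thesis .
  qed
qed

section \<open>Counting edges, degrees and unit sums\<close>

text \<open>Edges at \<open>x\<close> correspond to neighbours \<open>y\<close> through
  \<open>{x, y}\<close>. The condition \<open>x \<noteq> y\<close> is kept apart from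
  \<open>adj\<close>, since \<open>adj x x\<close> may hold: in the unit graph \<open>x + x\<close>
  can be a unit.\<close>

lemma card_edges_at:
  assumes "x \<in> V" and sym: "\<And>x y. adj x y \<Longrightarrow> adj y x"
  shows "card {e \<in> {{x, y} | x y. x \<in> V \<and> y \<in> V \<and> x \<noteq> y \<and> adj x y}. x \<in> e}
       = card {y\<in>V. x \<noteq> y \<and> adj x y}"
proof -
  have "{e \<in> {{x, y} | x y. x \<in> V \<and> y \<in> V \<and> x \<noteq> y \<and> adj x y}. x \<in> e}
      = (\<lambda>y. {x, y}) ` {y\<in>V. x \<noteq> y \<and> adj x y}"
    using assms by (auto simp: insert_commute)
  then show ?thesis
    by (simp add: card_image inj_on_def doubleton_eq_iff)
qed

lemma handshake:
  assumes V: "finite V" and sym: "\<And>x y. adj x y \<Longrightarrow> adj y x"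
  shows "2 * card {{x, y} | x y. x \<in> V \<and> y \<in> V \<and> x \<noteq> y \<and> adj x y}
       = (\<Sum>x\<in>V. card {y\<in>V. x \<noteq> y \<and> adj x y})"
proof -
  let ?E = "{{x, y} | x y. x \<in> V \<and> y \<in> V \<and> x \<noteq> y \<and> adj x y}"
  have finE: "finite ?E"
    using V by (intro finite_subset[of ?E "Pow V"]) auto
  have "(\<Sum>x\<in>V. card {y\<in>V. x \<noteq> y \<and> adj x y}) = (\<Sum>x\<in>V. card {e\<in>?E. x \<in> e})"
    using card_edges_at[where adj = adj, OF _ sym] by (intro sum.cong) auto
  also have "\<dots> = (\<Sum>e\<in>?E. 2)"
  proof (rule sum_multicount_gen[OF V finE], intro ballI)
    fix e assume "e \<in> ?E"
    then obtain x y where "e = {x, y}" "x \<in> V" "y \<in> V" "x \<noteq> y" by auto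
    then have "{z\<in>V. z \<in> e} = {x, y}" by auto
    then show "card {z\<in>V. z \<in> e} = 2" using \<open>x \<noteq> y\<close> by simp
  qed
  finally show ?thesis by simp
qed
text \<open>Translation by \<open>x\<close> permutes the residues modulo \<open>m\<close>, and
  reduction modulo \<open>m\<close> preserves coprimality to \<open>m\<close>.\<close>

lemma card_residues_add_coprime:
  assumes "m > 1"
  shows "card {y\<in>{0..int m - 1}. coprime (x + y) (int m)} = totient m"
proof -
  have "bij_betw (\<lambda>y. (x + y) mod int m) {y\<in>{0..int m - 1}. coprime (x + y) (int m)}
          {z\<in>{0..int m - 1}. coprime z (int m)}"
  proof (rule bij_betw_byWitness[where f' = "\<lambda>z. (z - x) mod int m"])
    show "(\<lambda>z. (z - x) mod int m) ` {z\<in>{0..int m - 1}. coprime z (int m)}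
        \<subseteq> {y\<in>{0..int m - 1}. coprime (x + y) (int m)}"
    proof (intro image_subsetI CollectI conjI)
      fix z assume "z \<in> {z\<in>{0..int m - 1}. coprime z (int m)}"
      then have "coprime ((x + (z - x) mod int m) mod int m) (int m)"
        by (simp add: mod_add_right_eq)
      then show "coprime (x + (z - x) mod int m) (int m)"
        using assms by simp
    qed (use assms in simp)
  qed (use assms in \<open>auto simp: mod_diff_left_eq mod_add_right_eq\<close>)
  then have "card {y\<in>{0..int m - 1}. coprime (x + y) (int m)}
      = card {z\<in>{0..int m - 1}. coprime z (int m)}"
    by (rule bij_betw_same_card)
  also have "{z\<in>{0..int m - 1}. coprime z (int m)} = int ` totatives m"
  proof (intro equalityI subsetI)
    fix z assume z: "z \<in> {z\<in>{0..int m - 1}. coprime z (int m)}"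
    \<comment> \<open>Totatives range over 1 to \<open>m\<close>, residues over 0 to
      \<open>m - 1\<close>. Since \<open>m > 1\<close>, neither 0 nor \<open>m\<close> is coprime to
      \<open>m\<close>, so the two ranges give the same set.\<close>
    moreover have "z \<noteq> 0" using z assms by (intro notI) auto
    ultimately have "nat z \<in> totatives m" "z = int (nat z)"
      by (auto simp: totatives_def simp flip: coprime_int_iff)
    then show "z \<in> int ` totatives m" by blast
  next
    fix z assume "z \<in> int ` totatives m"
    then obtain k where "z = int k" "k \<in> totatives m" by blast
    then show "z \<in> {z\<in>{0..int m - 1}. coprime z (int m)}"
      using assms totatives_less[of k m] by (simp add: totatives_def)
  qed
  also have "card \<dots> = totient m"
    by (simp add: card_image totient_def)
  finally show ?thesis .
qed

section \<open>The unit graph modulo a prime power\<close>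

locale unit_graph_prime_power =
  fixes p n m :: nat
  assumes prime: "prime p" and n: "n \<ge> 1" and m: "m = p ^ n"
begin

abbreviation "V \<equiv> carrier (residue_ring (int m))"
abbreviation "E \<equiv> unit_graph_edges (residue_ring (int m))"

lemma m_gt_1: "m > 1"
  using prime_gt_1_nat[OF prime] n one_less_power[of p n] by (simp add: m)

lemma V_eq: "V = {0..int m - 1}"
  by (simp add: residue_ring_def)

lemma finite_V: "finite V" and card_V: "card V = m"
  unfolding V_eq by simp_all

lemma coprime_m_iff: "coprime z (int m) \<longleftrightarrow> \<not> int p dvd z"
proof -
  have "coprime z (int m) \<longleftrightarrow> coprime (int p) z"
    using n by (simp add: m coprime_commute)
  also have "\<dots> \<longleftrightarrow> \<not> int p dvd z"
    using prime prime_imp_coprime[of "int p" z] coprime_common_divisor[of "int p" z "int p"]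
    by (auto dest: not_prime_unit)
  finally show ?thesis .
qed

text \<open>The units modulo \<open>p ^ n\<close> are the residues not divisible by
  \<open>p\<close>, so adjacency becomes a divisibility condition on the integer sum
  \<open>x + y\<close>.\<close>

lemma E_eq: "E = {{x, y} | x y. x \<in> V \<and> y \<in> V \<and> x \<noteq> y \<and> \<not> int p dvd x + y}"
proof -
  interpret R: residues "int m" "residue_ring (int m)"
    by unfold_locales (use m_gt_1 in auto)
  have "x \<oplus>\<^bsub>residue_ring (int m)\<^esub> y \<in> Units (residue_ring (int m)) \<longleftrightarrow> \<not> int p dvd x + y" for x y
  proof -
    have "z mod int m \<in> Units (residue_ring (int m)) \<longleftrightarrow> coprime z (int m)" for z
      using R.mod_in_res_units[of z] m_gt_1 by (auto simp: R.res_units_eq)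
    then show ?thesis by (simp add: R.res_add_eq coprime_m_iff)
  qed
  then show ?thesis unfolding unit_graph_edges_def by simp
qed

lemma card_unit_sum: "card {y\<in>V. \<not> int p dvd x + y} = totient m"
  using card_residues_add_coprime[OF m_gt_1, of x] by (simp only: coprime_m_iff V_eq)

text \<open>Exactly \<open>totient m\<close> residues \<open>y\<close> make \<open>x + y\<close> a
  unit; \<open>y = x\<close> is among them, and must be discarded as a loop, iff
  \<open>2 * x\<close> is a unit.\<close>

lemma degree:
  assumes "x \<in> V"
  shows "card {y\<in>V. x \<noteq> y \<and> \<not> int p dvd x + y}
       = (if int p dvd 2 * x then totient m else totient m - 1)"
proof -
  have "{y\<in>V. x \<noteq> y \<and> \<not> int p dvd x + y} = {y\<in>V. \<not> int p dvd x + y} - {x}" by auto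
  moreover have "x \<in> {y\<in>V. \<not> int p dvd x + y} \<longleftrightarrow> \<not> int p dvd 2 * x"
    using assms unfolding mult_2 by simp
  ultimately show ?thesis
    using card_unit_sum[of x] finite_V by (simp add: card_Diff_singleton_if)
qed

lemma card_E_odd:
  assumes "odd p"
  shows "card E = totient m * (m - 1) div 2"
proof -
  have dvd: "int p dvd 2 * x \<longleftrightarrow> int p dvd x" for x
    using assms prime by (simp add: coprime_dvd_mult_right_iff)
  have "2 * card E = (\<Sum>x\<in>V. if int p dvd x then totient m else totient m - 1)"
    unfolding E_eq using handshake[of V "\<lambda>x y. \<not> int p dvd x + y"] finite_V
    by (simp add: add.commute degree dvd)
  \<comment> \<open>Adding 1 at each vertex that lost its loop restores \<open>totient m\<close>
    everywhere and avoids truncated subtraction. These vertices are the units,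
    \<open>totient m\<close> in number.\<close>
  moreover have "(\<Sum>x\<in>V. if int p dvd x then totient m else totient m - 1)
      + (\<Sum>x\<in>V. if int p dvd x then 0 else 1) = (\<Sum>x\<in>V. totient m)"
    using m_gt_1 unfolding sum.distrib[symmetric] by (intro sum.cong) (auto simp: Suc_le_eq)
  moreover have "(\<Sum>x\<in>V. if int p dvd x then 0 else 1) = totient m"
    using card_unit_sum[of 0] finite_V by (simp add: sum.If_cases Int_def)
  ultimately have "2 * card E = totient m * (m - 1)"
    by (simp add: card_V algebra_simps)
  then show ?thesis by simp
qed

lemma totient_m_2:
  assumes "p = 2"
  shows "totient m = 2 ^ (n - 1)"
  using n totient_prime_power[of 2 n] by (simp add: m assms)

lemma card_E_2:
  assumes "p = 2"
  shows "card E = 2 ^ (2 * (n - 1))"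
proof -
  have "2 * card E = (\<Sum>x\<in>V. card {y\<in>V. x \<noteq> y \<and> \<not> int p dvd x + y})"
    unfolding E_eq by (rule handshake[OF finite_V]) (simp add: add.commute)
  \<comment> \<open>Every \<open>2 * x\<close> is even, so no loop is discarded and the graph is
    regular of degree \<open>totient m\<close>.\<close>
  also have "\<dots> = (\<Sum>x\<in>V. totient m)"
    by (intro sum.cong refl) (subst degree, auto simp: assms)
  also have "\<dots> = 2 ^ n * 2 ^ (n - 1)"
    unfolding sum_constant card_V totient_m_2[OF assms] by (simp add: m assms)
  also have "\<dots> = 2 * (2 ^ (n - 1) * 2 ^ (n - 1))"
    using n by (cases n) simp_all
  also have "2 ^ (n - 1) * 2 ^ (n - 1) = (2 :: nat) ^ (2 * (n - 1))"
    by (simp only: mult_2 power_add)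
  finally show ?thesis by simp
qed

lemma Union_E: "\<Union>E \<subseteq> V"
  unfolding E_eq by blast

lemma finite_E: "finite E"
  using Union_E finite_V by (meson finite_UnionD finite_subset)

lemma star:
  assumes "x \<in> V"
  shows "card {e\<in>E. x \<in> e} = (if int p dvd 2 * x then totient m else totient m - 1)"
  unfolding E_eq
  by (rule trans[OF card_edges_at[where adj = "\<lambda>x y. \<not> int p dvd x + y", OF assms] degree[OF assms]])
     (simp add: add.commute)

lemma zero_one_in_V: "0 \<in> V" "1 \<in> V"
  using m_gt_1 by (auto simp: V_eq)

section \<open>Odd \<open>p\<close> in characteristic 2\<close>

theorem row_code_char_2:
  assumes p: "odd p" and char: "(2 :: 'a::field) = 0" and H: "is_incidence_matrix V E H"
  shows "is_linear_code (row_code H :: 'a vec set)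
           (totient m * (m - 1) div 2) (m - 1) (totient m - 1)"
proof -
  define adj where "adj x y \<longleftrightarrow> x \<noteq> y \<and> \<not> int p dvd x + y" for x y
  have adj_sym: "adj x y \<Longrightarrow> adj y x" for x y
    by (simp add: adj_def add.commute)
  have mem_E: "{x, y} \<in> E" if "x \<in> V" "y \<in> V" "adj x y" for x y
    using that unfolding E_eq adj_def by blast
  have p1: "\<not> int p dvd 1"
    using prime by (auto simp: prime_nat_iff)
  \<comment> \<open>Distinct nonadjacent vertices have a sum divisible by \<open>p\<close>, so
    \<open>p\<close> divides both or neither: 1 is a common neighbour in the first case, 0 in the
    second.\<close>
  have common_nbr: "\<exists>z\<in>V. adj x z \<and> adj z y" if "x \<noteq> y" "\<not> adj x y" for x y
  proof -
    have xy: "int p dvd x + y" using that by (simp add: adj_def)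
    show ?thesis
    proof (cases "int p dvd x")
      case True
      then have "int p dvd y" using xy by (simp add: dvd_add_right_iff)
      with True p1 have "adj x 1 \<and> adj 1 y"
        by (auto simp: adj_def dvd_add_right_iff dvd_add_left_iff)
      then show ?thesis using zero_one_in_V by blast
    next
      case False
      then have "\<not> int p dvd y" using xy dvd_add_left_iff by blast
      with False have "adj x 0 \<and> adj 0 y" by (auto simp: adj_def)
      then show ?thesis using zero_one_in_V by blast
    qed
  qed
  have add_0: "a + b = 0 \<longleftrightarrow> a = b" for a b :: 'a
  proof -
    have "b + b = 0" using char by (metis mult_2 mult_zero_left)
    then show ?thesis by (metis add_right_cancel)
  qed
  have sum_edge: "sum f {x, y} = 0 \<longleftrightarrow> f x = f y" if "adj x y" for f :: "int \<Rightarrow> 'a" and x y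
    using that by (simp add: adj_def add_0)
  have edgeE: "\<exists>x y. e = {x, y} \<and> x \<in> V \<and> y \<in> V \<and> adj x y" if "e \<in> E" for e
    using that unfolding E_eq adj_def by blast
  have "odd m"
    using p by (simp add: m)
  then have "m > 2"
    using m_gt_1 by (cases "m = 2") auto
  then have pos: "totient m - 1 > 0"
    using totient_gt_1[of m] by simp
  have ker: "(\<forall>e\<in>E. sum f e = 0) \<longleftrightarrow> (\<exists>c. \<forall>x\<in>V. f x = c * 1)" for f :: "int \<Rightarrow> 'a"
  proof
    assume f: "\<forall>e\<in>E. sum f e = 0"
    have adj_eq: "f x = f y" if "x \<in> V" "y \<in> V" "adj x y" for x y
      using that f mem_E sum_edge by blast
    \<comment> \<open>Every vertex is 0, a neighbour of 0, or shares a neighbour with 0, so labels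
      that agree along edges are constant.\<close>
    have "f x = f 0" if "x \<in> V" for x
      using adj_eq common_nbr[of x 0] that zero_one_in_V by metis
    then show "\<exists>c. \<forall>x\<in>V. f x = c * 1" by auto
  next
    assume "\<exists>c. \<forall>x\<in>V. f x = c * 1"
    then obtain c where c: "\<And>x. x \<in> V \<Longrightarrow> f x = c" by auto
    show "\<forall>e\<in>E. sum f e = 0"
    proof
      fix e assume "e \<in> E"
      then obtain x y where "e = {x, y}" "x \<in> V" "y \<in> V" "adj x y" using edgeE by blast
      then show "sum f e = 0" using c sum_edge[of x y f] by simp
    qed
  qed
  have min: "totient m - 1 \<le> card {e\<in>E. sum f e \<noteq> 0}" if "\<exists>e\<in>E. sum f e \<noteq> 0" for f :: "int \<Rightarrow> 'a"
  proof -
    from that obtain e where e: "e \<in> E" "sum f e \<noteq> 0" by blast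
    from edgeE[OF e(1)] obtain x0 y0 where "e = {x0, y0}" "x0 \<in> V" "y0 \<in> V" "adj x0 y0"
      by blast
    with e(2) sum_edge[of x0 y0 f] have x0: "x0 \<in> V" "y0 \<in> V" "f x0 \<noteq> f y0" by auto
    \<comment> \<open>The field may have more than two elements, so the cut is taken around one
      level set of \<open>f\<close>. Its edges join different labels and hence lie in the support of
      the codeword.\<close>
    define S where "S = {x\<in>V. f x = f x0}"
    let ?cut = "{(x, y). x \<in> S \<and> y \<in> V - S \<and> adj x y}"
    have "totient m - 1 \<le> card ?cut"
    proof (rule edge_boundary_ge_if_diameter_2[OF finite_V])
      show "totient m - 1 \<le> card {y\<in>V. adj x y}" if "x \<in> V" for x
        using degree[OF that] by (simp add: adj_def)
    next
      have "x0 \<in> S" "y0 \<notin> S"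
        using x0 by (simp_all add: S_def)
      then show "S \<noteq> {}" "S \<noteq> V"
        using x0(2) by blast+
      show "S \<subseteq> V"
        unfolding S_def by blast
    next
      show "\<not> adj x x" for x
        by (simp add: adj_def)
    next
      show "\<exists>z\<in>V. adj x z \<and> adj z y" if "x \<noteq> y" "\<not> adj x y" for x y
        using common_nbr[OF that] .
    qed (fact adj_sym)
    \<comment> \<open>An edge determines its pair, because exactly one endpoint lies in
      \<open>S\<close>.\<close>
    also have "\<dots> = card ((\<lambda>(x, y). {x, y}) ` ?cut)"
    proof (intro card_image[symmetric] inj_onI)
      fix a b assume ab: "a \<in> ?cut" "b \<in> ?cut" "(\<lambda>(x, y). {x, y}) a = (\<lambda>(x, y). {x, y}) b"
      obtain x y u v where "a = (x, y)" "b = (u, v)" by fastforce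
      with ab show "a = b" by (auto simp: doubleton_eq_iff)
    qed
    also have "\<dots> \<le> card {e\<in>E. sum f e \<noteq> 0}"
    proof (rule card_mono)
      show "(\<lambda>(x, y). {x, y}) ` ?cut \<subseteq> {e\<in>E. sum f e \<noteq> 0}"
        using mem_E by (auto simp: S_def sum_edge simp del: sum.insert)
    qed (simp add: finite_E)
    finally show ?thesis .
  qed
  \<comment> \<open>The vertex 1 attains the minimum degree, as \<open>2 * 1\<close> is a unit for
    odd \<open>p\<close>.\<close>
  have star_1: "card {e\<in>E. 1 \<in> e} = totient m - 1"
  proof -
    have "\<not> int p dvd 2"
      using p prime primes_dvd_imp_eq[OF prime two_is_prime_nat] int_dvd_int_iff[of p 2] by auto
    then show ?thesis using star[OF zero_one_in_V(2)] by simp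
  qed
  have "is_linear_code (row_code H :: 'a vec set) (card E) (card V - 1) (totient m - 1)"
    by (rule is_linear_code_incidence[where s = "\<lambda>_. 1", OF H Union_E zero_one_in_V(1)
            one_neq_zero ker zero_one_in_V(2) star_1 pos min])
  then show ?thesis
    unfolding card_V card_E_odd[OF p] .
qed

section \<open>The case \<open>p = 2\<close>\<close>

theorem row_code_even_modulus:
  assumes p: "p = 2" and H: "is_incidence_matrix V E H"
  shows "is_linear_code (row_code H :: 'a::field vec set)
           (2 ^ (2 * (n - 1))) (2 ^ n - 1) (2 ^ (n - 1))"
proof -
  have edge: "e \<in> E \<longleftrightarrow> (\<exists>x y. e = {x, y} \<and> x \<in> V \<and> y \<in> V \<and> even x \<and> odd y)" for e
  proof -
    have "e \<in> E \<longleftrightarrow> (\<exists>x y. e = {x, y} \<and> x \<in> V \<and> y \<in> V \<and> x \<noteq> y \<and> odd (x + y))"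
      unfolding E_eq p by simp
    also have "\<dots> \<longleftrightarrow> (\<exists>x y. e = {x, y} \<and> x \<in> V \<and> y \<in> V \<and> even x \<and> odd y)"
    proof
      assume "\<exists>x y. e = {x, y} \<and> x \<in> V \<and> y \<in> V \<and> x \<noteq> y \<and> odd (x + y)"
      then obtain x y where "e = {x, y}" "x \<in> V" "y \<in> V" "odd (x + y)" by blast
      moreover from this have "e = {y, x}" by blast
      ultimately show "\<exists>x y. e = {x, y} \<and> x \<in> V \<and> y \<in> V \<and> even x \<and> odd y"
        by (cases "even x") auto
    qed fastforce
    finally show ?thesis .
  qed
  have sum_edge: "sum f {x, y} = f x + f y" if "even x" "odd y" for f :: "int \<Rightarrow> 'a" and x y
    using that by (subst sum.insert) auto
  have evens: "card {x\<in>V. even x} = totient m" and odds: "card {y\<in>V. odd y} = totient m"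
    using card_unit_sum[of 1] card_unit_sum[of 0] by (simp_all add: p)
  \<comment> \<open>Labels cancelling on every edge of a complete bipartite graph are constant on
    each side, with opposite values on the two sides.\<close>
  define s :: "int \<Rightarrow> 'a" where "s x = (if even x then 1 else - 1)" for x
  have ker: "(\<forall>e\<in>E. sum f e = 0) \<longleftrightarrow> (\<exists>c. \<forall>x\<in>V. f x = c * s x)" for f :: "int \<Rightarrow> 'a"
  proof
    assume f: "\<forall>e\<in>E. sum f e = 0"
    have edge_0: "f x + f y = 0" if "x \<in> V" "y \<in> V" "even x" "odd y" for x y
      using f that edge sum_edge by metis
    have "f x = f 0 * s x" if "x \<in> V" for x
    proof (cases "even x")
      case True
      then show ?thesis
        using edge_0[of x 1] edge_0[of 0 1] that zero_one_in_V
        by (simp add: s_def eq_neg_iff_add_eq_0[symmetric])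
    next
      case False
      then show ?thesis
        using edge_0[of 0 x] that zero_one_in_V by (simp add: s_def eq_neg_iff_add_eq_0 add.commute)
    qed
    then show "\<exists>c. \<forall>x\<in>V. f x = c * s x" by blast
  next
    assume "\<exists>c. \<forall>x\<in>V. f x = c * s x"
    then show "\<forall>e\<in>E. sum f e = 0" by (auto simp: edge sum_edge s_def)
  qed
  \<comment> \<open>If every even vertex lies on a nonzero edge, choosing one for each gives
    \<open>totient m\<close> distinct edges. Otherwise some even \<open>x0\<close> has only zero
    edges, so \<open>f\<close> is constant on the odd side, and an even vertex with one nonzero edge
    has only nonzero edges.\<close>
  have min: "totient m \<le> card {e\<in>E. sum f e \<noteq> 0}" if nz: "\<exists>e\<in>E. sum f e \<noteq> 0" for f :: "int \<Rightarrow> 'a"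
  proof (cases "\<forall>x\<in>{x\<in>V. even x}. \<exists>y\<in>{y\<in>V. odd y}. f x + f y \<noteq> 0")
    case True
    then have "\<forall>x\<in>{x\<in>V. even x}. \<exists>y. y \<in> V \<and> odd y \<and> f x + f y \<noteq> 0" by blast
    from bchoice[OF this] obtain h
      where h: "\<And>x. x \<in> V \<Longrightarrow> even x \<Longrightarrow> h x \<in> V \<and> odd (h x) \<and> f x + f (h x) \<noteq> 0"
      by blast
    have "inj_on (\<lambda>x. {x, h x}) {x\<in>V. even x}"
      using h by (auto simp: inj_on_def doubleton_eq_iff)
    then have "totient m = card ((\<lambda>x. {x, h x}) ` {x\<in>V. even x})"
      by (simp add: card_image evens)
    also have "\<dots> \<le> card {e\<in>E. sum f e \<noteq> 0}"
    proof (rule card_mono)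
      show "(\<lambda>x. {x, h x}) ` {x\<in>V. even x} \<subseteq> {e\<in>E. sum f e \<noteq> 0}"
        using h by (auto simp: edge sum_edge simp del: sum.insert)
    qed (simp add: finite_E)
    finally show ?thesis .
  next
    case False
    then obtain x0 where x0: "\<And>y. y \<in> V \<Longrightarrow> odd y \<Longrightarrow> f x0 + f y = 0" by blast
    from nz obtain x y where xy: "x \<in> V" "y \<in> V" "even x" "odd y" "f x + f y \<noteq> 0"
      using edge sum_edge by metis
    \<comment> \<open>Both \<open>f y\<close> and \<open>f z\<close> equal \<open>- f x0\<close>, so
      \<open>f x + f z\<close> is the nonzero value \<open>f x + f y\<close>.\<close>
    have nz_x: "f x + f z \<noteq> 0" if "z \<in> V" "odd z" for z
      using x0[OF that] x0[of y] xy by (metis add_left_cancel)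
    have "inj_on (\<lambda>z. {x, z}) {z\<in>V. odd z}"
      by (simp add: inj_on_def doubleton_eq_iff)
    then have "totient m = card ((\<lambda>z. {x, z}) ` {z\<in>V. odd z})"
      by (simp add: card_image odds)
    also have "\<dots> \<le> card {e\<in>E. sum f e \<noteq> 0}"
    proof (rule card_mono)
      show "(\<lambda>z. {x, z}) ` {z\<in>V. odd z} \<subseteq> {e\<in>E. sum f e \<noteq> 0}"
        using nz_x xy by (auto simp: edge sum_edge simp del: sum.insert)
    qed (simp add: finite_E)
    finally show ?thesis .
  qed
  have star_0: "card {e\<in>E. 0 \<in> e} = totient m"
    using star[OF zero_one_in_V(1)] by simp
  have pos: "totient m > 0"
    using m_gt_1 by simp
  have s_0: "s 0 \<noteq> 0"
    by (simp add: s_def)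
  have "is_linear_code (row_code H :: 'a vec set) (card E) (card V - 1) (totient m)"
    by (rule is_linear_code_incidence[where s = s, OF H Union_E zero_one_in_V(1) s_0 ker
            zero_one_in_V(1) star_0 pos min])
  then show ?thesis
    unfolding card_V card_E_2[OF p] totient_m_2[OF p] unfolding m p .
qed

end

section \<open>The concrete prime fields\<close>

text \<open>The cardinality of the index type is 0 in \<open>mod_ring\<close>, and
  \<open>CARD(bool)\<close> is 2.\<close>

lemma two_eq_0_bool_mod_ring: "(2 :: bool mod_ring) = 0"
  using of_nat_card_eq_0[where 'a = bool]
  by simp

theorem theorem3p7:
  fixes p n :: nat and H :: "int mat"
  assumes "prime p" and "n \<ge> 1"
    and "is_incidence_matrix
           (carrier (residue_ring (int (p ^ n)))) (unit_graph_edges (residue_ring (int (p ^ n)))) H"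
  shows "(odd p \<longrightarrow>
            is_linear_code (row_code H :: bool mod_ring vec set)
              (totient (p ^ n) * (p ^ n - 1) div 2) (p ^ n - 1) (totient (p ^ n) - 1)) \<and>
         (p = 2 \<longrightarrow> odd CARD('q::prime_card) \<longrightarrow>
            is_linear_code (row_code H :: 'q mod_ring vec set)
              (2 ^ (2 * (n - 1))) (2 ^ n - 1) (2 ^ (n - 1)))"
proof -
  interpret unit_graph_prime_power p n "p ^ n"
    by unfold_locales (use assms in simp_all)
  show ?thesis
    using row_code_char_2[OF _ two_eq_0_bool_mod_ring assms(3)]
      row_code_even_modulus[OF _ assms(3), where 'a = "'q mod_ring"]
    by blast
qed

end
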